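(* Let $\mu,\nu\ge0$ be constant integers, and let $n,k,f\ge1$. Assume the Erdős Girth Conjecture. Then there exists a simple $(\mu,\nu)$-list-colored graph $G$ with $n$ vertices such that every $f$-CFT $(2k-1)$-spanner of $G$ has $\Omega(\min\{f^{\mu+\nu(1-1/k)}n^{1+1/k},n^2\})$ edges.
   Context: Erdős Girth Conjecture: for all integers $n,k\ge1$ there is an $n$-vertex graph of girth at least $2k+2$ with $\Omega(n^{1+1/k})$ edges. Each edge and each vertex $x$ of $G$ has a list $\ell(x)$ of colors. $G$ is $(\mu,\nu)$-list-colored if edge lists have size at most $\mu$ and vertex lists have size at most $\nu$. A color $c$ damages an edge $e=\{u,v\}$ if $c\in\ell(e)\cup\ell(u)\cup\ell(v)$. For a set $F$ of colors, $G-F$ deletes all edges damaged by a color of $F$. An $f$-CFT $t$-spanner of $G$ is a subgraph $H$ (inheriting lists) such that for every set $F$ of at most $f$ colors, $\operatorname{dist}_{H-F}(u,v)\le t\cdot\operatorname{dist}_{G-F}(u,v)$ for all vertices $u,v$. *)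

theory Defs
  imports Complex_Main "HOL-Library.Extended_Nat"
begin

definition simple_graph :: "'v set \<Rightarrow> 'v set set \<Rightarrow> bool" where
  "simple_graph V E \<longleftrightarrow> finite V \<and> (\<forall>e\<in>E. e \<subseteq> V \<and> card e = 2)"

definition walk :: "'v set set \<Rightarrow> 'v list \<Rightarrow> bool" where
  "walk E p \<longleftrightarrow> p \<noteq> [] \<and> (\<forall>i. Suc i < length p \<longrightarrow> {p ! i, p ! Suc i} \<in> E)"

text \<open>Walks are lists of vertices, so a walk \<open>p\<close> has \<open>length p - 1\<close> edges. The infimum over the
  empty set is \<open>\<infinity>\<close>, which gives the usual value for disconnected pairs.\<close>

definition gdist :: "'v set set \<Rightarrow> 'v \<Rightarrow> 'v \<Rightarrow> enat" where
  "gdist E u v = (INF p \<in> {p. walk E p \<and> hd p = u \<and> last p = v}. enat (length p - 1))"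

text \<open>A cycle is listed without repeating its first vertex; an acyclic graph has girth \<open>\<infinity>\<close>.\<close>

definition is_cycle :: "'v set set \<Rightarrow> 'v list \<Rightarrow> bool" where
  "is_cycle E p \<longleftrightarrow> 3 \<le> length p \<and> distinct p \<and> walk E p \<and> {last p, hd p} \<in> E"

definition girth :: "'v set set \<Rightarrow> enat" where
  "girth E = (INF p \<in> {p. is_cycle E p}. enat (length p))"

text \<open>The constant hidden in \<open>\<Omega>(n\<^sup>1\<^sup>+\<^sup>1\<^sup>/\<^sup>k)\<close> is absolute. The one-vertex graph has no edges, so the
  literal inequality fails at \<open>n = 1\<close> for every positive constant; the range therefore starts
  at \<open>n = 2\<close>. Any larger fixed starting point gives an equivalent statement, since the finitely
  many remaining \<open>n\<close> are covered by a single edge and a smaller constant.\<close>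

definition erdos_girth_conjecture :: bool where
  "erdos_girth_conjecture \<longleftrightarrow>
     (\<exists>c::real. c > 0 \<and>
       (\<forall>n\<ge>2. \<forall>k\<ge>1. \<exists>(V :: nat set) E.
          simple_graph V E \<and> card V = n \<and> enat (2 * k + 2) \<le> girth E \<and>
          c * real n powr (1 + 1 / real k) \<le> real (card E)))"

definition list_colored ::
    "nat \<Rightarrow> nat \<Rightarrow> 'v set \<Rightarrow> 'v set set \<Rightarrow> ('v set \<Rightarrow> 'c set) \<Rightarrow> ('v \<Rightarrow> 'c set) \<Rightarrow> bool" where
  "list_colored \<mu> \<nu> V E le lv \<longleftrightarrow>
     (\<forall>e\<in>E. finite (le e) \<and> card (le e) \<le> \<mu>) \<and> (\<forall>v\<in>V. finite (lv v) \<and> card (lv v) \<le> \<nu>)"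

definition damages :: "('v set \<Rightarrow> 'c set) \<Rightarrow> ('v \<Rightarrow> 'c set) \<Rightarrow> 'c \<Rightarrow> 'v set \<Rightarrow> bool" where
  "damages le lv c e \<longleftrightarrow> c \<in> le e \<union> (\<Union>v\<in>e. lv v)"

definition delete_colors ::
    "('v set \<Rightarrow> 'c set) \<Rightarrow> ('v \<Rightarrow> 'c set) \<Rightarrow> 'v set set \<Rightarrow> 'c set \<Rightarrow> 'v set set" where
  "delete_colors le lv E F = {e \<in> E. \<not> (\<exists>c\<in>F. damages le lv c e)}"

text \<open>A spanner is given by its edge set \<open>H\<close>; its vertex set is \<open>V\<close> and it keeps the lists of the
  host graph.\<close>

definition cft_spanner ::
    "nat \<Rightarrow> nat \<Rightarrow> 'v set \<Rightarrow> 'v set set \<Rightarrow> ('v set \<Rightarrow> 'c set) \<Rightarrow> ('v \<Rightarrow> 'c set) \<Rightarrow> 'v set set \<Rightarrow> bool" where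
  "cft_spanner f t V E le lv H \<longleftrightarrow> H \<subseteq> E \<and>
     (\<forall>F. finite F \<and> card F \<le> f \<longrightarrow>
       (\<forall>u\<in>V. \<forall>v\<in>V.
          gdist (delete_colors le lv H F) u v \<le> enat t * gdist (delete_colors le lv E F) u v))"

end

theory Submission
  imports Defs "HOL-Library.Nat_Bijection"
begin

text \<open>Cut a graph from the girth conjecture into two sides, and place \<open>s\<^sup>\<mu>\<close> cyclic shifts of the
  resulting bipartite graph on \<open>{..<m} \<times> {..<m}\<close>, chosen greedily so that the union stays large. Blow
  each side up into about \<open>s\<^sup>\<nu>\<close> classes, where \<open>s\<close> is of order \<open>f\<close>, and color a class by the \<open>\<nu>\<close>
  base-\<open>s\<close> digits of its index and an edge by the \<open>\<mu>\<close> digits of the index of its shift. Deleting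
  all wrong digits isolates one shift between one pair of classes, in which girth at least \<open>2k + 2\<close>
  forces every edge into a \<open>(2k - 1)\<close>-spanner. So the graph is its own only spanner.\<close>

section \<open>Graphs from which no spanner can omit an edge\<close>

text \<open>\<open>spread t E\<close>: a \<open>t\<close>-spanner cannot omit any edge. Unlike girth, this pulls back along maps
  that are injective on edges only.\<close>

definition spread :: "nat \<Rightarrow> 'v set set \<Rightarrow> bool" where
  "spread t E \<longleftrightarrow> (\<forall>u v p. {u, v} \<in> E \<and> walk (E - {{u, v}}) p \<and> hd p = u \<and> last p = v \<longrightarrow>
     t < length p - 1)"

lemma walk_iff_successively: "walk E p \<longleftrightarrow> p \<noteq> [] \<and> successively (\<lambda>x y. {x, y} \<in> E) p"
  by (auto simp: walk_def successively_conv_nth)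

lemma walk_mono: "walk E p \<Longrightarrow> E \<subseteq> E' \<Longrightarrow> walk E' p"
  by (auto simp: walk_def)

lemma walk_map:
  assumes "walk E p" and "\<And>e. e \<in> E \<Longrightarrow> \<phi> ` e \<in> E'"
  shows "walk E' (map \<phi> p)"
  using assms(1) assms(2)[of "{_, _}"] by (auto simp: walk_def)

lemma walk_imp_distinct_walk:
  assumes "walk E p"
  obtains p' where "walk E p'" "distinct p'" "hd p' = hd p" "last p' = last p" "length p' \<le> length p"
proof -
  have "\<exists>p'. walk E p' \<and> distinct p' \<and> hd p' = hd p \<and> last p' = last p \<and> length p' \<le> length p"
    using assms
  proof (induction "length p" arbitrary: p rule: less_induct)
    case less
    show ?case
    proof (cases "distinct p")
      case True
      then show ?thesis using less.prems by blast
    next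
      case False
      then obtain xs y ys zs where p: "p = xs @ [y] @ ys @ [y] @ zs"
        using not_distinct_decomp by blast
      let ?p = "xs @ [y] @ zs"
      have w: "walk E ?p"
        using less.prems unfolding p walk_iff_successively
        by (auto simp: successively_append_iff successively_Cons)
      have ends: "hd ?p = hd p" "last ?p = last p" "length ?p < length p"
        unfolding p by (auto simp: hd_append)
      show ?thesis using less.hyps[OF ends(3) w] ends by (metis less_imp_le order_trans)
    qed
  qed
  then show ?thesis using that by blast
qed

text \<open>A detour around the edge {u, v} can be shortened to a path; if the path has j vertices,
  the edge closes it to a cycle of length j. So girth at least t + 2 leaves every detour with at
  least t + 1 edges.\<close>

lemma spread_if_girth:
  assumes edges: "\<And>e. e \<in> E \<Longrightarrow> card e = 2" and g: "enat (t + 2) \<le> girth E"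
  shows "spread t E"
  unfolding spread_def
proof (intro allI impI, elim conjE)
  fix u v p
  assume uv: "{u, v} \<in> E" and w: "walk (E - {{u, v}}) p" and h: "hd p = u" and l: "last p = v"
  obtain q where q: "walk (E - {{u, v}}) q" "distinct q" "hd q = u" "last q = v" "length q \<le> length p"
    using walk_imp_distinct_walk[OF w] h l by metis
  have "u \<noteq> v" using edges[OF uv] by auto
  \<comment> \<open>With one vertex u = v; with two the walk would use the removed edge.\<close>
  have "3 \<le> length q"
  proof (rule ccontr)
    assume "\<not> 3 \<le> length q"
    then consider "q = []" | x where "q = [x]" | x y where "q = [x, y]"
      by (cases q; cases "tl q"; cases "tl (tl q)") auto
    then show False
      using q \<open>u \<noteq> v\<close> by cases (auto simp: walk_iff_successively)
  qed
  moreover have "walk E q" using q(1) walk_mono by blast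
  ultimately have "is_cycle E q"
    using q uv by (auto simp: is_cycle_def insert_commute)
  then have "girth E \<le> enat (length q)"
    unfolding girth_def by (auto intro: INF_lower)
  then have "t + 2 \<le> length q" using g by (metis enat_ord_simps(1) order_trans)
  then show "t < length p - 1" using q(5) by linarith
qed

text \<open>Injectivity on edges keeps the image of a detour off the image of the edge it avoids,
  and mapping preserves length. The map may identify vertices, as the projection of a blow-up
  does.\<close>

lemma spread_hom:
  assumes sp: "spread t E'" and hom: "\<And>e. e \<in> E \<Longrightarrow> \<phi> ` e \<in> E'" and inj: "inj_on ((`) \<phi>) E"
  shows "spread t E"
  unfolding spread_def
proof (intro allI impI, elim conjE)
  fix u v p
  assume uv: "{u, v} \<in> E" and w: "walk (E - {{u, v}}) p" and h: "hd p = u" and l: "last p = v"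
  have "walk (E' - {{\<phi> u, \<phi> v}}) (map \<phi> p)"
  proof (rule walk_map[OF w])
    fix e assume e: "e \<in> E - {{u, v}}"
    then have "\<phi> ` e \<noteq> \<phi> ` {u, v}" using inj_onD[OF inj, of e "{u, v}"] uv by blast
    then show "\<phi> ` e \<in> E' - {{\<phi> u, \<phi> v}}" using hom e by auto
  qed
  moreover have "{\<phi> u, \<phi> v} \<in> E'" using hom[OF uv] by simp
  moreover have "p \<noteq> []" using w by (simp add: walk_def)
  ultimately have "t < length (map \<phi> p) - 1"
    using sp h l unfolding spread_def by (metis hd_map last_map)
  then show "t < length p - 1" by simp
qed

section \<open>Bipartite base graphs from the girth conjecture\<close>

text \<open>Vertices join one at a time, each on the side opposite to the larger share of its
  earlier neighbors, so at least half of the new edges are cut. Pairs have their first entry in S,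
  so a cut edge is counted once.\<close>

lemma exists_large_cut:
  assumes "finite V" and "\<And>e. e \<in> E \<Longrightarrow> e \<subseteq> V \<and> card e = 2"
  shows "\<exists>S\<subseteq>V. card E \<le> 2 * card {(x, y). x \<in> S \<and> y \<in> V - S \<and> {x, y} \<in> E}"
  using assms
proof (induction V arbitrary: E rule: finite_induct)
  case empty
  then have "E = {}" by force
  then show ?case by simp
next
  case (insert v V)
  define E1 where "E1 = {e \<in> E. v \<notin> e}"
  define N where "N = {x. x \<in> V \<and> {x, v} \<in> E}"
  have "\<exists>S\<subseteq>V. card E1 \<le> 2 * card {(x, y). x \<in> S \<and> y \<in> V - S \<and> {x, y} \<in> E1}"
    by (rule insert.IH) (use insert.prems in \<open>auto simp: E1_def\<close>)
  then obtain S where S: "S \<subseteq> V"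
    and cut: "card E1 \<le> 2 * card {(x, y). x \<in> S \<and> y \<in> V - S \<and> {x, y} \<in> E1}" by blast
  let ?P = "{(x, y). x \<in> S \<and> y \<in> V - S \<and> {x, y} \<in> E1}"
  have fN: "finite N" using insert.hyps by (simp add: N_def)
  have "E \<subseteq> Pow (insert v V)" using insert.prems by blast
  then have fE: "finite E" using insert.hyps finite_subset by blast
  have "E = E1 \<union> (\<lambda>x. {x, v}) ` N"
  proof
    show "E \<subseteq> E1 \<union> (\<lambda>x. {x, v}) ` N"
    proof
      fix e assume e: "e \<in> E"
      show "e \<in> E1 \<union> (\<lambda>x. {x, v}) ` N"
      proof (cases "v \<in> e")
        case True
        obtain a b where ab: "e = {a, b}" "a \<noteq> b" using insert.prems[OF e] by (auto simp: card_2_iff)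
        then obtain x where "e = {x, v}" "x \<noteq> v" using True by (metis doubleton_eq_iff insertE singletonD)
        then show ?thesis using e insert.prems[OF e] by (auto simp: N_def)
      qed (use e in \<open>simp add: E1_def\<close>)
    qed
  qed (auto simp: E1_def N_def)
  then have "card E \<le> card E1 + card ((\<lambda>x. {x, v}) ` N)"
    using card_Un_le by metis
  also have "\<dots> \<le> card E1 + card N" using card_image_le[OF fN] by simp
  also have "card N = card (N \<inter> S) + card (N - S)"
    using fN by (metis Diff_Diff_Int card_Diff_subset_Int card_Int_Diff finite_Diff)
  finally have cardE: "card E \<le> card E1 + (card (N \<inter> S) + card (N - S))" .
  have fP: "finite ?P"
    by (rule finite_subset[of _ "V \<times> V"]) (use S insert.hyps in auto)
  show ?case
  proof (cases "card (N - S) \<le> card (N \<inter> S)")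
    case True
    let ?Q = "{(x, y). x \<in> S \<and> y \<in> insert v V - S \<and> {x, y} \<in> E}"
    have "?P \<union> (\<lambda>x. (x, v)) ` (N \<inter> S) \<subseteq> ?Q"
      using S insert.hyps by (auto simp: E1_def N_def)
    moreover have "finite ?Q"
      by (rule finite_subset[of _ "insert v V \<times> insert v V"]) (use S insert.hyps in auto)
    ultimately have "card (?P \<union> (\<lambda>x. (x, v)) ` (N \<inter> S)) \<le> card ?Q" by (rule card_mono[rotated])
    moreover have "card (?P \<union> (\<lambda>x. (x, v)) ` (N \<inter> S)) = card ?P + card ((\<lambda>x. (x, v)) ` (N \<inter> S))"
      by (rule card_Un_disjoint) (use fP fN insert.hyps in auto)
    moreover have "card ((\<lambda>x. (x, v)) ` (N \<inter> S)) = card (N \<inter> S)"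
      by (rule card_image) (auto simp: inj_on_def)
    ultimately have "card E \<le> 2 * card ?Q" using cardE cut True by linarith
    then show ?thesis using S by blast
  next
    case False
    let ?Q = "{(x, y). x \<in> insert v S \<and> y \<in> insert v V - insert v S \<and> {x, y} \<in> E}"
    have "?P \<union> (\<lambda>y. (v, y)) ` (N - S) \<subseteq> ?Q"
      using S insert.hyps by (auto simp: E1_def N_def insert_commute)
    moreover have "finite ?Q"
      by (rule finite_subset[of _ "insert v V \<times> insert v V"]) (use S insert.hyps in auto)
    ultimately have "card (?P \<union> (\<lambda>y. (v, y)) ` (N - S)) \<le> card ?Q" by (rule card_mono[rotated])
    moreover have "card (?P \<union> (\<lambda>y. (v, y)) ` (N - S)) = card ?P + card ((\<lambda>y. (v, y)) ` (N - S))"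
      by (rule card_Un_disjoint) (use fP fN insert.hyps S in auto)
    moreover have "card ((\<lambda>y. (v, y)) ` (N - S)) = card (N - S)"
      by (rule card_image) (auto simp: inj_on_def)
    ultimately have "card E \<le> 2 * card ?Q" using cardE cut False by linarith
    moreover have "insert v S \<subseteq> insert v V" using S by blast
    ultimately show ?thesis by blast
  qed
qed

text \<open>Encoding graphs by pairs turns their shifts and unions into operations on subsets of a
  grid; the sum type separates equal labels on the two sides.\<close>

definition bip :: "(nat \<times> nat) set \<Rightarrow> (nat + nat) set set" where
  "bip B = (\<lambda>(x, y). {Inl x, Inr y}) ` B"

lemma exists_dense_spread_bip:
  assumes "erdos_girth_conjecture"
  shows "\<exists>c::real. 0 < c \<and> (\<forall>m\<ge>1. \<forall>k\<ge>1. \<exists>B. B \<subseteq> {..<m} \<times> {..<m} \<and>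
    spread (2 * k - 1) (bip B) \<and> c * real m powr (1 + 1 / real k) \<le> real (card B))"
proof -
  obtain c :: real where c: "c > 0" and G: "\<And>n k. n \<ge> 2 \<Longrightarrow> k \<ge> 1 \<Longrightarrow> \<exists>(V :: nat set) E.
          simple_graph V E \<and> card V = n \<and> enat (2 * k + 2) \<le> girth E \<and>
          c * real n powr (1 + 1 / real k) \<le> real (card E)"
    using assms unfolding erdos_girth_conjecture_def by blast
  have "\<exists>B. B \<subseteq> {..<m} \<times> {..<m} \<and>
    spread (2 * k - 1) (bip B) \<and> c / 2 * real m powr (1 + 1 / real k) \<le> real (card B)"
    if m: "m \<ge> 1" and k: "k \<ge> 1" for m k :: nat
  proof -
    \<comment> \<open>One vertex to spare: both sides of a nontrivial cut of \<open>m + 1\<close> vertices fit into \<open>{..<m}\<close>.\<close>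
    obtain V :: "nat set" and E where VE: "simple_graph V E" "card V = m + 1"
      and g: "enat (2 * k + 2) \<le> girth E"
      and cE: "c * real (m + 1) powr (1 + 1 / real k) \<le> real (card E)"
      using G[of "m + 1" k] m k by auto
    have fV: "finite V" and eV: "\<And>e. e \<in> E \<Longrightarrow> e \<subseteq> V \<and> card e = 2"
      using VE by (auto simp: simple_graph_def)
    obtain S where S: "S \<subseteq> V"
      and cut: "card E \<le> 2 * card {(x, y). x \<in> S \<and> y \<in> V - S \<and> {x, y} \<in> E}"
      using exists_large_cut[OF fV eV] by blast
    let ?P = "{(x, y). x \<in> S \<and> y \<in> V - S \<and> {x, y} \<in> E}"
    have "enat (2 * k - 1 + 2) \<le> girth E" using g k
      by (metis add_le_mono1 diff_le_self enat_ord_simps(1) order_trans)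
    then have spE: "spread (2 * k - 1) E" using spread_if_girth eV by blast
    \<comment> \<open>The conjecture supplies a positive number of edges, so the cut contains one
      and neither side is empty.\<close>
    have "0 < c * real (m + 1) powr (1 + 1 / real k)" using c by simp
    then have "0 < card E" using cE by linarith
    then have "?P \<noteq> {}" using cut by (metis card.empty mult_0_right not_less)
    then have "S \<noteq> {}" "V - S \<noteq> {}" by auto
    moreover have fS: "finite S" using S fV finite_subset by blast
    ultimately have "card (V - S) < card V" "card S < card V"
      using S fV by (auto intro!: psubset_card_mono)
    then have cS: "card S \<le> m" "card (V - S) \<le> m" using VE by auto
    obtain h where h: "inj_on h S" "h ` S \<subseteq> {..<m}"
      using card_le_inj[OF fS, of "{..<m}"] cS by auto
    obtain h' where h': "inj_on h' (V - S)" "h' ` (V - S) \<subseteq> {..<m}"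
      using card_le_inj[of "V - S" "{..<m}"] cS fV by auto
    define B where "B = map_prod h h' ` ?P"
    have inj: "inj_on (map_prod h h') ?P"
      using h(1) h'(1) by (auto simp: inj_on_def)
    have cB: "card B = card ?P" unfolding B_def using inj by (rule card_image)
    define \<phi> where "\<phi> = case_sum (inv_into S h) (inv_into (V - S) h')"
    have \<phi>: "\<phi> ` {Inl (h x), Inr (h' y)} = {x, y}" if "x \<in> S" "y \<in> V - S" for x y
      using that h(1) h'(1) by (simp add: \<phi>_def)
    have "spread (2 * k - 1) (bip B)"
    proof (rule spread_hom[OF spE, of _ \<phi>])
      fix e assume "e \<in> bip B"
      then obtain x y where "x \<in> S" "y \<in> V - S" "{x, y} \<in> E" "e = {Inl (h x), Inr (h' y)}"
        by (auto simp: bip_def B_def)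
      then show "\<phi> ` e \<in> E" using \<phi> by simp
    next
      show "inj_on ((`) \<phi>) (bip B)"
      proof (rule inj_onI)
        fix e e' assume "e \<in> bip B" "e' \<in> bip B" and eq: "\<phi> ` e = \<phi> ` e'"
        then obtain x y x' y' where xy: "x \<in> S" "y \<in> V - S" "e = {Inl (h x), Inr (h' y)}"
            "x' \<in> S" "y' \<in> V - S" "e' = {Inl (h x'), Inr (h' y')}"
          by (auto simp: bip_def B_def)
        then have "{x, y} = {x', y'}" using eq \<phi> by simp
        \<comment> \<open>No swap is possible because S and V - S are disjoint.\<close>
        then have "x = x'" "y = y'" using xy by (auto simp: doubleton_eq_iff)
        then show "e = e'" using xy by simp
      qed
    qed
    moreover have "B \<subseteq> {..<m} \<times> {..<m}" using h(2) h'(2) by (auto simp: B_def)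
    moreover have "c / 2 * real m powr (1 + 1 / real k) \<le> real (card B)"
    proof -
      have "c * real m powr (1 + 1 / real k) \<le> c * real (m + 1) powr (1 + 1 / real k)"
        using c by (intro mult_left_mono powr_mono2) auto
      also have "\<dots> \<le> 2 * real (card B)" using cE cut cB by linarith
      finally show ?thesis by simp
    qed
    ultimately show ?thesis by blast
  qed
  then show ?thesis using c by (intro exI[of _ "c / 2"]) auto
qed

section \<open>Cyclic shifts with a large union\<close>

text \<open>Translations of the torus of side m. The coordinates move independently, so exactly one
  translation modulo m takes a given point to another given point; the averaging below relies on
  this.\<close>

definition shift :: "nat \<Rightarrow> nat \<times> nat \<Rightarrow> nat \<times> nat \<Rightarrow> nat \<times> nat" where
  "shift m t = map_prod (\<lambda>x. (x + fst t) mod m) (\<lambda>y. (y + snd t) mod m)"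

lemma bij_betw_mod_add:
  fixes x m :: nat
  assumes "x < m"
  shows "bij_betw (\<lambda>t. (x + t) mod m) {..<m} {..<m}"
proof -
  have inj: "inj_on (\<lambda>t. (x + t) mod m) {..<m}"
  proof (rule inj_onI)
    fix a b assume ab: "a \<in> {..<m}" "b \<in> {..<m}" "(x + a) mod m = (x + b) mod m"
    then obtain i j where "a + m * i = b + m * j" by (auto simp: nat_mod_eq_iff)
    then have "(a + m * i) mod m = (b + m * j) mod m" by simp
    then show "a = b" using ab by simp
  qed
  moreover have "(\<lambda>t. (x + t) mod m) ` {..<m} = {..<m}"
    by (rule endo_inj_surj) (use inj assms in auto)
  ultimately show ?thesis by (simp add: bij_betw_def)
qed

lemma inj_on_mod_add:
  fixes t m :: nat
  shows "inj_on (\<lambda>x. (x + t) mod m) {..<m}"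
proof (cases "m = 0")
  case False
  have "inj_on (\<lambda>x. (t mod m + x) mod m) {..<m}"
    using bij_betw_mod_add[of "t mod m" m] False by (simp add: bij_betw_def)
  then show ?thesis by (simp add: mod_simps add.commute)
qed simp

lemma inj_on_shift: "inj_on (shift m t) ({..<m} \<times> {..<m})"
  unfolding shift_def by (intro map_prod_inj_on inj_on_mod_add)

lemma shift_subset: "B \<subseteq> {..<m} \<times> {..<m} \<Longrightarrow> shift m t ` B \<subseteq> {..<m} \<times> {..<m}"
  by (auto simp: shift_def intro!: mod_less_divisor intro: gr_zeroI)

lemma spread_shift:
  assumes sp: "spread k (bip B)" and B: "B \<subseteq> {..<m} \<times> {..<m}"
  shows "spread k (bip (shift m t ` B))"
proof (rule spread_hom[OF sp])
  let ?f = "\<lambda>x. (x + fst t) mod m" and ?g = "\<lambda>x. (x + snd t) mod m"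
  let ?\<phi> = "map_sum (inv_into {..<m} ?f) (inv_into {..<m} ?g)"
  have \<phi>: "?\<phi> ` {Inl (?f x), Inr (?g y)} = {Inl x, Inr y}" if "(x, y) \<in> B" for x y
    using that B by (auto simp: inv_into_f_f[OF inj_on_mod_add])
  show "?\<phi> ` e \<in> bip B" if e: "e \<in> bip (shift m t ` B)" for e
  proof -
    obtain x y where "(x, y) \<in> B" "e = {Inl (?f x), Inr (?g y)}"
      using e by (auto simp: bip_def shift_def)
    then show ?thesis using \<phi> by (force simp: bip_def)
  qed
  show "inj_on ((`) ?\<phi>) (bip (shift m t ` B))"
  proof (rule inj_onI)
    fix e e' assume "e \<in> bip (shift m t ` B)" "e' \<in> bip (shift m t ` B)" and eq: "?\<phi> ` e = ?\<phi> ` e'"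
    then obtain x y x' y' where xy: "(x, y) \<in> B" "e = {Inl (?f x), Inr (?g y)}"
        "(x', y') \<in> B" "e' = {Inl (?f x'), Inr (?g y')}"
      by (auto simp: bip_def shift_def)
    then have "{Inl x, Inr y} = {Inl x', Inr y' :: nat + nat}" using eq \<phi> by simp
    then show "e = e'" using xy by (auto simp: doubleton_eq_iff)
  qed
qed

text \<open>Averaging over all \<open>m\<^sup>2\<close> shifts: each point of \<open>B\<close> hits each point of \<open>U\<close> exactly once.\<close>

lemma exists_shift_small_overlap:
  assumes m: "0 < m" and B: "B \<subseteq> {..<m} \<times> {..<m}" and U: "U \<subseteq> {..<m} \<times> {..<m}"
  shows "\<exists>t. card (shift m t ` B \<inter> U) * m\<^sup>2 \<le> card B * card U"
proof (rule ccontr)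
  let ?T = "{..<m} \<times> {..<m}"
  assume "\<not> ?thesis"
  then have big: "card B * card U < card (shift m t ` B \<inter> U) * m\<^sup>2" for t
    by (metis not_le)
  have fB: "finite B" and fU: "finite U" using B U finite_subset by blast+
  have inj: "inj_on (shift m t) B" for t using inj_on_shift B inj_on_subset by blast
  have c1: "card (shift m t ` B \<inter> U) = (\<Sum>b\<in>B. if shift m t b \<in> U then 1 else 0)" for t
  proof -
    have "shift m t ` B \<inter> U = shift m t ` {b \<in> B. shift m t b \<in> U}" by blast
    also have "card \<dots> = card {b \<in> B. shift m t b \<in> U}"
      by (rule card_image) (use inj[of t] in \<open>auto simp: inj_on_def\<close>)
    finally show ?thesis using fB by (simp add: sum.If_cases Int_def)
  qed
  have c2: "(\<Sum>t\<in>?T. if shift m t b \<in> U then 1 else 0) = card U" if "b \<in> B" for b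
  proof -
    have b: "fst b < m" "snd b < m" using that B by auto
    have "bij_betw (map_prod (\<lambda>t. (fst b + t) mod m) (\<lambda>t. (snd b + t) mod m)) ?T ?T"
      by (intro bij_betw_map_prod bij_betw_mod_add b)
    moreover have "map_prod (\<lambda>t. (fst b + t) mod m) (\<lambda>t. (snd b + t) mod m) = (\<lambda>t. shift m t b)"
      by (auto simp: shift_def map_prod_def split: prod.splits)
    ultimately have bij: "bij_betw (\<lambda>t. shift m t b) ?T ?T" by simp
    have "(\<Sum>t\<in>?T. if shift m t b \<in> U then 1 else 0) = (\<Sum>u\<in>?T. if u \<in> U then 1 else 0 :: nat)"
      by (rule sum.reindex_bij_betw[OF bij])
    also have "\<dots> = card (?T \<inter> U)" by (simp add: sum.If_cases)
    also have "?T \<inter> U = U" using U by blast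
    finally show ?thesis .
  qed
  have "(\<Sum>t\<in>?T. card (shift m t ` B \<inter> U)) = (\<Sum>b\<in>B. \<Sum>t\<in>?T. if shift m t b \<in> U then 1 else 0)"
    unfolding c1 by (rule sum.swap)
  also have "\<dots> = card B * card U" using c2 by simp
  finally have total: "(\<Sum>t\<in>?T. card (shift m t ` B \<inter> U)) = card B * card U" .
  have "(\<Sum>t\<in>?T. card B * card U) < (\<Sum>t\<in>?T. card (shift m t ` B \<inter> U) * m\<^sup>2)"
    by (rule sum_strict_mono) (use big m in auto)
  also have "\<dots> = m\<^sup>2 * (card B * card U)"
    unfolding sum_distrib_right[symmetric] total by simp
  finally show False by (simp add: power2_eq_square)
qed

text \<open>Greedy choice: while the union covers less than half of the grid, some shift overlaps it
  in at most half of \<open>card B\<close> points and so adds at least the other half. Once half of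
  the grid is covered, the bound holds for good.\<close>

lemma exists_shifts_large_union:
  assumes m: "0 < m" and B: "B \<subseteq> {..<m} \<times> {..<m}"
  shows "\<exists>t. min (N * card B) (m\<^sup>2) \<le> 2 * card (\<Union>i<N. shift m (t i) ` B)"
proof (induction N)
  case (Suc N)
  then obtain t where t: "min (N * card B) (m\<^sup>2) \<le> 2 * card (\<Union>i<N. shift m (t i) ` B)" by blast
  let ?U = "\<Union>i<N. shift m (t i) ` B"
  have U: "?U \<subseteq> {..<m} \<times> {..<m}" using shift_subset[OF B] by blast
  then have fU: "finite ?U" using finite_subset by blast
  have fB: "finite B" using B finite_subset by blast
  obtain s where s: "card (shift m s ` B \<inter> ?U) * m\<^sup>2 \<le> card B * card ?U"
    using exists_shift_small_overlap[OF m B U] by blast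
  let ?A = "shift m s ` B"
  have cA: "card ?A = card B"
    by (rule card_image) (use inj_on_shift B inj_on_subset in blast)
  have union: "(\<Union>i<Suc N. shift m ((t(N := s)) i) ` B) = ?U \<union> ?A"
    by (auto simp: lessThan_Suc)
  have "card (?U \<union> ?A) + card (?A \<inter> ?U) = card ?U + card B"
    using card_Un_Int[OF fU, of ?A] fB cA by (simp add: Int_commute)
  moreover have "card ?U \<le> card (?U \<union> ?A)"
    by (rule card_mono) (use fU fB in auto)
  moreover have "2 * card (?A \<inter> ?U) \<le> card B" if "2 * card ?U < m\<^sup>2"
  proof -
    have "(2 * card (?A \<inter> ?U)) * m\<^sup>2 \<le> card B * (2 * card ?U)" using s by simp
    also have "\<dots> \<le> card B * m\<^sup>2" using that by simp
    finally show ?thesis using m by simp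
  qed
  ultimately have "min (Suc N * card B) (m\<^sup>2) \<le> 2 * card (?U \<union> ?A)"
    using t by (cases "2 * card ?U < m\<^sup>2") (auto simp: min_def split: if_splits)
  then show ?case using union by metis
qed simp

section \<open>Digit lists that isolate one index\<close>

lemma mod_power_eq_if_digits_eq:
  fixes a b s :: nat
  assumes "\<And>i. i < r \<Longrightarrow> a div s ^ i mod s = b div s ^ i mod s"
  shows "a mod s ^ r = b mod s ^ r"
  using assms
proof (induction r)
  case (Suc r)
  then have "a mod s ^ r = b mod s ^ r" "a div s ^ r mod s = b div s ^ r mod s" by simp_all
  then show ?case by (simp only: power_Suc2 mod_mult2_eq)
qed simp

text \<open>A color (i, d) stands for digit d at position i in base s. \<open>L a\<close> holds the
  r digits of a, and \<open>F a\<close> all wrong ones, s - 1 for each position. An index that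
  avoids \<open>F a\<close> agrees with a in every digit, hence equals a.\<close>

lemma exists_isolating_lists:
  fixes r s :: nat
  assumes s: "0 < s"
  obtains L F :: "nat \<Rightarrow> nat set" where
    "\<And>a. finite (L a)" "\<And>a. card (L a) \<le> r" "\<And>a. finite (F a)" "\<And>a. card (F a) \<le> r * (s - 1)"
    "\<And>a b. a < s ^ r \<Longrightarrow> b < s ^ r \<Longrightarrow> L b \<inter> F a = {} \<longleftrightarrow> b = a"
proof
  let ?L = "\<lambda>a. (\<lambda>i. prod_encode (i, a div s ^ i mod s)) ` {..<r}"
  let ?F = "\<lambda>a. prod_encode ` (SIGMA i:{..<r}. {..<s} - {a div s ^ i mod s})"
  show "finite (?L a)" "finite (?F a)" for a by auto
  show "card (?L a) \<le> r" for a using card_image_le[of "{..<r}"] by force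
  have "card (SIGMA i:{..<r}. {..<s} - {a div s ^ i mod s}) = r * (s - 1)" for a
    using s by (simp add: card_SigmaI)
  then show "card (?F a) \<le> r * (s - 1)" for a
    using card_image_le[of "SIGMA i:{..<r}. {..<s} - {a div s ^ i mod s}" prod_encode] by simp
  show "?L b \<inter> ?F a = {} \<longleftrightarrow> b = a" if "a < s ^ r" "b < s ^ r" for a b
  proof
    assume disj: "?L b \<inter> ?F a = {}"
    \<comment> \<open>As s > 0, the digit of b is below s; if it differed from that of a, its color
      would lie in \<open>?F a\<close>.\<close>
    have "b div s ^ i mod s = a div s ^ i mod s" if "i < r" for i
      using disj that s by (fastforce simp: disjoint_iff)
    then have "b mod s ^ r = a mod s ^ r" by (rule mod_power_eq_if_digits_eq)
    then show "b = a" using that by simp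
  qed auto
qed

section \<open>Edges forced into fault-tolerant spanners\<close>

lemma obtain_walk_if_gdist_le:
  assumes "gdist E u v \<le> enat t"
  obtains p where "walk E p" "hd p = u" "last p = v" "length p - 1 \<le> t"
proof -
  let ?D = "(\<lambda>p. enat (length p - 1)) ` {p. walk E p \<and> hd p = u \<and> last p = v}"
  have "?D \<noteq> {}"
    using assms unfolding gdist_def by (metis Inf_empty enat_ord_simps(5) infinity_ileE top_enat_def)
  then have "Inf ?D \<in> ?D"
    unfolding Inf_enat_def using LeastI_ex[of "\<lambda>x. x \<in> ?D"] by auto
  then obtain p where "walk E p" "hd p = u" "last p = v" "gdist E u v = enat (length p - 1)"
    unfolding gdist_def by auto
  then show ?thesis using assms that by simp
qed

text \<open>After the faults, a spanner without the edge would need a detour of at most t edges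
  inside the surviving graph, which spread excludes. So one suitable fault set per edge forces that
  edge.\<close>

lemma spread_edge_in_spanner:
  assumes H: "cft_spanner f t V E le lv H" and t: "1 \<le> t"
    and F: "finite F" "card F \<le> f" and sp: "spread t (delete_colors le lv E F)"
    and e: "{u, v} \<in> delete_colors le lv E F" and uv: "u \<in> V" "v \<in> V"
  shows "{u, v} \<in> H"
proof (rule ccontr)
  assume nH: "{u, v} \<notin> H"
  have "walk (delete_colors le lv E F) [u, v]" using e by (simp add: walk_iff_successively)
  then have "gdist (delete_colors le lv E F) u v \<le> enat 1"
    unfolding gdist_def by (intro INF_lower2[of "[u, v]"]) auto
  then have "enat t * gdist (delete_colors le lv E F) u v \<le> enat t * enat 1"
    by (rule mult_left_mono) simp
  moreover have "gdist (delete_colors le lv H F) u v \<le> enat t * gdist (delete_colors le lv E F) u v"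
    using H F uv unfolding cft_spanner_def by blast
  ultimately have "gdist (delete_colors le lv H F) u v \<le> enat t" by (auto intro: order_trans)
  then obtain p where p: "walk (delete_colors le lv H F) p" "hd p = u" "last p = v" "length p - 1 \<le> t"
    by (rule obtain_walk_if_gdist_le)
  have "delete_colors le lv H F \<subseteq> delete_colors le lv E F - {{u, v}}"
    using H nH unfolding cft_spanner_def delete_colors_def by blast
  then have "walk (delete_colors le lv E F - {{u, v}}) p" using p(1) walk_mono by blast
  then have "t < length p - 1" using sp e p(2,3) unfolding spread_def by blast
  then show False using p(4) by simp
qed

section \<open>The colored blow-up\<close>

text \<open>Left vertices are the even numbers \<open>2 (a m + x)\<close> and right vertices the odd numbers
  \<open>2 (b m + y) + 1\<close>, where \<open>a, b < q\<close> are the classes. Colors carry a tag 0, 1 or 2 that separates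
  the palettes of left vertices, right vertices and edges.\<close>

lemma exists_list_colored_blowup:
  fixes A :: "nat \<Rightarrow> (nat \<times> nat) set"
  assumes m: "0 < m" and s: "0 < s" and q: "q \<le> s ^ \<nu>" and n: "2 * (q * m) \<le> n" and t: "1 \<le> t"
    and f: "(2 * \<nu> + \<mu>) * (s - 1) \<le> f"
    and A: "\<And>i. i < s ^ \<mu> \<Longrightarrow> A i \<subseteq> {..<m} \<times> {..<m}"
    and sp: "\<And>i. i < s ^ \<mu> \<Longrightarrow> spread t (bip (A i))"
  shows "\<exists>(V :: nat set) E (le :: nat set \<Rightarrow> nat set) (lv :: nat \<Rightarrow> nat set).
    simple_graph V E \<and> card V = n \<and> list_colored \<mu> \<nu> V E le lv \<and>
    (\<forall>H. cft_spanner f t V E le lv H \<longrightarrow> q\<^sup>2 * card (\<Union>i<s ^ \<mu>. A i) \<le> card H)"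
proof -
  obtain LV FV :: "nat \<Rightarrow> nat set" where LV: "\<And>a. finite (LV a)" "\<And>a. card (LV a) \<le> \<nu>"
    and FV: "\<And>a. finite (FV a)" "\<And>a. card (FV a) \<le> \<nu> * (s - 1)"
    and isoV: "\<And>a b. a < s ^ \<nu> \<Longrightarrow> b < s ^ \<nu> \<Longrightarrow> LV b \<inter> FV a = {} \<longleftrightarrow> b = a"
    using exists_isolating_lists[OF s, of \<nu>] by metis
  obtain LE FE :: "nat \<Rightarrow> nat set" where LE: "\<And>a. finite (LE a)" "\<And>a. card (LE a) \<le> \<mu>"
    and FE: "\<And>a. finite (FE a)" "\<And>a. card (FE a) \<le> \<mu> * (s - 1)"
    and isoE: "\<And>a b. a < s ^ \<mu> \<Longrightarrow> b < s ^ \<mu> \<Longrightarrow> LE b \<inter> FE a = {} \<longleftrightarrow> b = a"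
    using exists_isolating_lists[OF s, of \<mu>] by metis
  define U where "U = (\<Union>i<s ^ \<mu>. A i)"
  have U: "U \<subseteq> {..<m} \<times> {..<m}" unfolding U_def using A by blast
  \<comment> \<open>The shifts overlap, so each point of the union is charged to its least shift
    index. The points charged to i lie in \<open>A i\<close>, whose spread property is then
    available.\<close>
  define ix where "ix = (\<lambda>z. LEAST i. i < s ^ \<mu> \<and> z \<in> A i)"
  have ix: "ix z < s ^ \<mu>" "z \<in> A (ix z)" if "z \<in> U" for z
  proof -
    have "\<exists>i. i < s ^ \<mu> \<and> z \<in> A i" using that by (auto simp: U_def)
    from LeastI_ex[OF this] show "ix z < s ^ \<mu>" "z \<in> A (ix z)" by (simp_all add: ix_def)
  qed
  define I where "I = U \<times> ({..<q} \<times> {..<q})"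
  define l where "l = (\<lambda>x a. 2 * (a * m + x))"
  define r where "r = (\<lambda>y b. 2 * (b * m + y) + 1)"
  define ed where "ed = (\<lambda>((x, y), (a, b)). {l x a, r y b})"
  \<comment> \<open>Forgets the class and keeps side and base label. It collapses the blow-up but is
    injective on the edges between one fixed pair of classes.\<close>
  define \<phi> :: "nat \<Rightarrow> nat + nat" where
    "\<phi> = (\<lambda>v. if even v then Inl (v div 2 mod m) else Inr (v div 2 mod m))"
  have l: "even (l x a)" "l x a div 2 mod m = x" "l x a div 2 div m = a" if "x < m" for x a
    using that by (simp_all add: l_def)
  have r: "odd (r y b)" "r y b div 2 mod m = y" "r y b div 2 div m = b" if "y < m" for y b
    using that by (simp_all add: r_def)
  have \<phi>ed: "\<phi> ` ed ((x, y), (a, b)) = {Inl x, Inr y}" if "(x, y) \<in> U" for x y a b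
    using that U l r by (auto simp: \<phi>_def ed_def)
  have inj: "inj_on ed I"
  proof (rule inj_onI)
    fix z z' assume z: "z \<in> I" "z' \<in> I" "ed z = ed z'"
    obtain x y a b x' y' a' b' where zz: "z = ((x, y), (a, b))" "z' = ((x', y'), (a', b'))"
      by (metis surj_pair)
    have lt: "x < m" "y < m" "x' < m" "y' < m" using z U by (auto simp: zz I_def)
    have "{l x a, r y b} = {l x' a', r y' b'}" using z by (simp add: zz ed_def)
    moreover have "l x a \<noteq> r y' b'" using l(1)[OF lt(1)] r(1)[OF lt(4)] by metis
    ultimately have "l x a = l x' a'" "r y b = r y' b'" by (auto simp: doubleton_eq_iff)
    then show "z = z'" using l r lt unfolding zz by metis
  qed
  \<comment> \<open>Vertices from 2 q m on are isolated and pad the count to n.\<close>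
  define V where "V = {..<n}"
  define E where "E = ed ` I"
  define le where "le = (\<lambda>e. (\<lambda>c. prod_encode (2, c)) ` LE (ix (fst (inv_into I ed e))))"
  \<comment> \<open>Parity is the palette tag. Padding vertices get lists too; the size bound for
    \<open>LV\<close> holds at every index.\<close>
  define lv where "lv = (\<lambda>v. (\<lambda>c. prod_encode (v mod 2, c)) ` LV (v div 2 div m))"
  have le_ed: "le (ed (z, w)) = (\<lambda>c. prod_encode (2, c)) ` LE (ix z)" if "(z, w) \<in> I" for z w
    using inv_into_f_f[OF inj that] by (simp add: le_def)
  have lv_l: "lv (l x a) = (\<lambda>c. prod_encode (0, c)) ` LV a" if "x < m" for x a
    using l[OF that] by (simp add: lv_def even_iff_mod_2_eq_zero)
  have lv_r: "lv (r y b) = (\<lambda>c. prod_encode (1, c)) ` LV b" if "y < m" for y b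
    using r[OF that] by (simp add: lv_def odd_iff_mod_2_eq_one)
  have bound: "l x a < n" "r x a < n" if "x < m" "a < q" for x a
  proof -
    have "a * m + x < Suc a * m" using that by simp
    also have "\<dots> \<le> q * m" using that by (intro mult_le_mono1) simp
    finally show "l x a < n" "r x a < n" using n by (simp_all add: l_def r_def)
  qed
  have "simple_graph V E"
    unfolding simple_graph_def
  proof (intro conjI ballI)
    fix e assume "e \<in> E"
    then obtain x y a b where e: "e = {l x a, r y b}" "x < m" "y < m" "a < q" "b < q"
      using U by (auto simp: E_def I_def ed_def)
    moreover have "l x a \<noteq> r y b" using l(1)[of x a] r(1)[of y b] e by metis
    ultimately show "e \<subseteq> V" "card e = 2" using bound by (auto simp: V_def)
  qed (simp add: V_def)
  moreover have "card V = n" by (simp add: V_def)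
  moreover have "list_colored \<mu> \<nu> V E le lv"
    unfolding list_colored_def le_def lv_def
    using LV LE by (auto intro: order_trans[OF card_image_le])
  moreover have "q\<^sup>2 * card U \<le> card H" if H: "cft_spanner f t V E le lv H" for H
  proof -
    have "E \<subseteq> H"
    proof
      fix e assume "e \<in> E"
      then obtain x y a b where e: "e = ed ((x, y), (a, b))" and xyU: "(x, y) \<in> U"
        and ab: "a < q" "b < q" by (auto simp: E_def I_def)
      let ?i = "ix (x, y)"
      let ?tag = "\<lambda>\<kappa> c. prod_encode (\<kappa>, c)"
      \<comment> \<open>These faults spare only class a on the left, class b on the right and shift
        index \<open>?i\<close>. The two classes have \<nu> digits each and the index \<mu>, with s
        - 1 wrong values per digit.\<close>
      define F where "F = ?tag 0 ` FV a \<union> ?tag 1 ` FV b \<union> ?tag 2 ` FE ?i"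
      have finF: "finite F" using FV FE by (simp add: F_def)
      have "card F \<le> card (?tag 0 ` FV a) + card (?tag 1 ` FV b) + card (?tag 2 ` FE ?i)"
        unfolding F_def by (meson add_le_mono1 card_Un_le order_trans)
      also have "\<dots> \<le> \<nu> * (s - 1) + \<nu> * (s - 1) + \<mu> * (s - 1)"
        by (intro add_mono order_trans[OF card_image_le] FV FE)
      also have "\<dots> = (2 * \<nu> + \<mu>) * (s - 1)" by (simp add: algebra_simps)
      finally have cF: "card F \<le> f" using f by simp
      have iso: "(\<exists>c\<in>F. damages le lv c (ed ((x', y'), (a', b')))) \<longleftrightarrow>
          \<not> (a' = a \<and> b' = b \<and> ix (x', y') = ?i)"
        if z: "(x', y') \<in> U" "a' < q" "b' < q" for x' y' a' b'
      proof -
        have lt: "x' < m" "y' < m" using z U by auto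
        have zI: "((x', y'), (a', b')) \<in> I" using z by (simp add: I_def)
        have "(\<exists>c\<in>F. damages le lv c (ed ((x', y'), (a', b')))) \<longleftrightarrow>
            F \<inter> (le (ed ((x', y'), (a', b'))) \<union> (lv (l x' a') \<union> lv (r y' b'))) \<noteq> {}"
          by (auto simp: damages_def ed_def)
        \<comment> \<open>Different tags make the three palettes disjoint, so avoiding F splits into
          three separate conditions.\<close>
        also have "\<dots> \<longleftrightarrow> \<not> (LV a' \<inter> FV a = {} \<and> LV b' \<inter> FV b = {} \<and> LE (ix (x', y')) \<inter> FE ?i = {})"
          unfolding le_ed[OF zI] lv_l[OF lt(1)] lv_r[OF lt(2)] F_def by auto
        also have "\<dots> \<longleftrightarrow> \<not> (a' = a \<and> b' = b \<and> ix (x', y') = ?i)"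
          using isoV[of a a'] isoV[of b b'] isoE[of ?i "ix (x', y')"] z ab q ix(1) xyU by simp
        finally show ?thesis .
      qed
      let ?E = "delete_colors le lv E F"
      have surv: "\<exists>x' y'. e' = ed ((x', y'), (a, b)) \<and> (x', y') \<in> U \<and> (x', y') \<in> A ?i"
        if e': "e' \<in> ?E" for e'
      proof -
        obtain x' y' a' b' where 1: "e' = ed ((x', y'), (a', b'))" "(x', y') \<in> U" "a' < q" "b' < q"
          using e' by (auto simp: delete_colors_def E_def I_def)
        have "a' = a \<and> b' = b \<and> ix (x', y') = ?i"
          using iso[OF 1(2-4)] e' unfolding 1(1) delete_colors_def by blast
        then show ?thesis using 1 ix(2)[OF 1(2)] by metis
      qed
      have "e \<in> ?E"
        using \<open>e \<in> E\<close> iso[OF xyU ab] by (auto simp: delete_colors_def e)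
      moreover have "spread t ?E"
      \<comment> \<open>Survivors share the classes a and b, so forgetting classes is injective on
        them, and their spread comes from the single shift \<open>A ?i\<close>.\<close>
      proof (rule spread_hom[OF sp[of ?i], of _ \<phi>])
        show "?i < s ^ \<mu>" using ix xyU by simp
        show "\<phi> ` e' \<in> bip (A ?i)" if "e' \<in> ?E" for e'
          using surv[OF that] \<phi>ed by (force simp: bip_def)
        show "inj_on ((`) \<phi>) ?E"
        proof (rule inj_onI)
          fix e1 e2 assume "e1 \<in> ?E" "e2 \<in> ?E" and eq: "\<phi> ` e1 = \<phi> ` e2"
          then obtain x1 y1 x2 y2 where 1: "e1 = ed ((x1, y1), (a, b))" "(x1, y1) \<in> U"
              "e2 = ed ((x2, y2), (a, b))" "(x2, y2) \<in> U"
            using surv by metis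
          then have "{Inl x1, Inr y1} = {Inl x2, Inr y2 :: nat + nat}" using eq \<phi>ed by simp
          then show "e1 = e2" using 1 by (auto simp: doubleton_eq_iff)
        qed
      qed
      moreover have "e = {l x a, r y b}" by (simp add: e ed_def)
      moreover have "l x a \<in> V" "r y b \<in> V" using xyU U ab bound by (auto simp: V_def)
      ultimately show "e \<in> H" using spread_edge_in_spanner[OF H t finF cF] by simp
    qed
    then have "H = E" using H by (auto simp: cft_spanner_def)
    then show ?thesis
      using card_image[OF inj] by (simp add: E_def I_def card_cartesian_product power2_eq_square)
  qed
  ultimately show ?thesis unfolding U_def by blast
qed

section \<open>The size estimate\<close>

text \<open>If the union fills half the grid, q^2 u is of order (q m)^2, hence at least of order
  n^2. Otherwise u is at least half of s^\<mu> M. Then, for q = s^\<nu>, the bounds f <= D s and n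
  <= 4 q m compare q^2 u with the first term of the minimum; for n <= 3 q, already q^2 is of order
  n^2.\<close>

lemma blowup_size_bound:
  fixes n k f \<mu> \<nu> q m s M u :: nat and c :: real
  assumes n: "2 \<le> n" and k: "1 \<le> k" and f: "1 \<le> f" and c: "0 < c" "c \<le> 1"
  defines "D \<equiv> 2 * \<nu> + \<mu> + 1"
  assumes s: "real f \<le> real D * real s"
    and q: "1 \<le> q" "q = s ^ \<nu> \<or> n \<le> 3 * q" and m: "1 \<le> m" and nqm: "n \<le> 4 * (q * m)"
    and M: "c * real m powr (1 + 1 / real k) \<le> real M"
    and u: "min (s ^ \<mu> * M) (m\<^sup>2) \<le> 2 * u"
  shows "c / (32 * real D ^ (\<mu> + \<nu>)) *
      min (real f powr (real \<mu> + real \<nu> * (1 - 1 / real k)) * real n powr (1 + 1 / real k)) ((real n)\<^sup>2)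
    \<le> real (q\<^sup>2 * u)" (is "?C * min ?X ?Y \<le> _")
proof -
  \<comment> \<open>The class count q enters n^p with exponent p and, as q = s^\<nu>, the power of f
    with exponent w; p + w = 2 matches the q^2 pairs of classes.\<close>
  define p where "p = 1 + 1 / real k"
  define w where "w = 1 - 1 / real k"
  have p: "0 \<le> p" "p \<le> 2" and w: "0 \<le> w" "w \<le> 1" and pw: "p + w = 2"
    using k by (auto simp: p_def w_def)
  have D: "1 \<le> real D" by (simp add: D_def)
  then have D1: "1 \<le> real D ^ (\<mu> + \<nu>)" by (rule one_le_power)
  have spos: "0 < s" using s f by (cases s) auto
  have C32: "?C \<le> c / 32" using D1 c by (intro frac_le) auto
  have C0: "0 \<le> ?C" using c D1 by simp
  have large: ?thesis if Y: "c * ?Y \<le> 32 * real (q\<^sup>2 * u)"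
  proof -
    have "?C * min ?X ?Y \<le> ?C * ?Y" using C0 by (intro mult_left_mono) auto
    also have "\<dots> \<le> c / 32 * ?Y" using C32 by (rule mult_right_mono) simp
    also have "\<dots> \<le> real (q\<^sup>2 * u)" using Y by simp
    finally show ?thesis .
  qed
  have nr: "real n \<le> 4 * (real q * real m)"
    using nqm by (metis of_nat_le_iff of_nat_mult of_nat_numeral)
  show ?thesis
  proof (cases "m\<^sup>2 \<le> 2 * u")
    case True
    have "(real n)\<^sup>2 \<le> (4 * (real q * real m))\<^sup>2" using nr by (rule power_mono) simp
    also have "\<dots> = 16 * ((real q)\<^sup>2 * real (m\<^sup>2))" by (simp add: power_mult_distrib)
    also have "\<dots> \<le> 16 * ((real q)\<^sup>2 * real (2 * u))"
      using True by (intro mult_left_mono) (simp_all del: of_nat_power of_nat_mult)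
    finally have "?Y \<le> 32 * real (q\<^sup>2 * u)" by simp
    moreover have "c * ?Y \<le> ?Y" using c by (simp add: mult_left_le_one_le)
    ultimately show ?thesis using large by linarith
  next
    case False
    then have sM: "s ^ \<mu> * M \<le> 2 * u" using u by (simp add: min_def split: if_splits)
    have "real s ^ \<mu> * (c * real m powr p) \<le> real s ^ \<mu> * real M"
      using M by (intro mult_left_mono) (auto simp: p_def)
    also have "\<dots> \<le> 2 * real u" using sM by (metis of_nat_le_iff of_nat_mult of_nat_numeral of_nat_power)
    finally have u2: "c * (real s ^ \<mu> * real m powr p) \<le> 2 * real u" by (simp add: algebra_simps)
    show ?thesis
    proof (cases "q = s ^ \<nu>")
      case True
      have "real f powr (real \<mu> + real \<nu> * w) \<le> (real D * real s) powr (real \<mu> + real \<nu> * w)"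
        using s w by (intro powr_mono2) auto
      also have "\<dots> = real D powr (real \<mu> + real \<nu> * w) * real s powr (real \<mu> + real \<nu> * w)"
        by (rule powr_mult)
      also have "\<dots> \<le> real D ^ (\<mu> + \<nu>) * real s powr (real \<mu> + real \<nu> * w)"
      proof (rule mult_right_mono)
        have "real D powr (real \<mu> + real \<nu> * w) \<le> real D powr real (\<mu> + \<nu>)"
          using D w by (intro powr_mono) (auto simp: mult_left_le)
        then show "real D powr (real \<mu> + real \<nu> * w) \<le> real D ^ (\<mu> + \<nu>)"
          using D by (simp add: powr_realpow del: of_nat_add)
      qed simp
      also have "real s powr (real \<mu> + real \<nu> * w) = real s ^ \<mu> * real q powr w"
        using spos True by (simp add: powr_add powr_realpow powr_powr[symmetric])
      finally have fb: "real f powr (real \<mu> + real \<nu> * w) \<le> real D ^ (\<mu> + \<nu>) * (real s ^ \<mu> * real q powr w)" .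
      have "real n powr p \<le> (4 * (real q * real m)) powr p"
        using nr p by (intro powr_mono2) auto
      also have "\<dots> = 4 powr p * (real q powr p * real m powr p)" by (simp add: powr_mult)
      \<comment> \<open>p <= 2 replaces 4^p by 16, so the constant does not depend on k.\<close>
      also have "\<dots> \<le> 4 powr 2 * (real q powr p * real m powr p)"
        using p by (intro mult_right_mono powr_mono) auto
      finally have nb: "real n powr p \<le> 16 * (real q powr p * real m powr p)" by simp
      have q2: "real q powr p * real q powr w = (real q)\<^sup>2"
        using q(1) by (simp add: powr_add[symmetric] pw)
      have "?X \<le> (real D ^ (\<mu> + \<nu>) * (real s ^ \<mu> * real q powr w)) * (16 * (real q powr p * real m powr p))"
        using mult_mono[OF fb nb] by (simp add: p_def w_def)
      also have "\<dots> = 16 * real D ^ (\<mu> + \<nu>) * ((real q powr p * real q powr w) * (real s ^ \<mu> * real m powr p))"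
        by (simp only: mult_ac)
      finally have X: "?X \<le> 16 * real D ^ (\<mu> + \<nu>) * ((real q)\<^sup>2 * (real s ^ \<mu> * real m powr p))"
        unfolding q2 .
      have "?C * min ?X ?Y \<le> ?C * ?X" using C0 by (intro mult_left_mono) auto
      also have "\<dots> \<le> ?C * (16 * real D ^ (\<mu> + \<nu>) * ((real q)\<^sup>2 * (real s ^ \<mu> * real m powr p)))"
        using X C0 by (rule mult_left_mono)
      also have "\<dots> = (real q)\<^sup>2 / 2 * (c * (real s ^ \<mu> * real m powr p))"
        using D by (simp add: field_simps)
      also have "\<dots> \<le> (real q)\<^sup>2 / 2 * (2 * real u)"
        using u2 by (rule mult_left_mono) simp
      finally show ?thesis by simp
    next
      case False
      then have "real n \<le> 3 * real q" using q(2) by linarith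
      then have "(real n)\<^sup>2 \<le> (3 * real q)\<^sup>2" by (rule power_mono) simp
      then have nq: "(real n)\<^sup>2 \<le> 9 * (real q)\<^sup>2" by (simp add: power_mult_distrib)
      \<comment> \<open>Since s, m >= 1, \<open>u2\<close> bounds u below by c / 2, enough when q^2
        alone is of order n^2.\<close>
      have "1 \<le> real s ^ \<mu> * real m powr p"
        using spos m p mult_mono[of 1 "real s ^ \<mu>" 1 "real m powr p"]
        by (auto simp: ge_one_powr_ge_zero)
      then have "c \<le> 2 * real u" using u2 c by (metis less_imp_le mult.right_neutral mult_left_mono order_trans)
      then have "c * (real n)\<^sup>2 \<le> (2 * real u) * (9 * (real q)\<^sup>2)"
        using nq c by (intro mult_mono) auto
      also have "\<dots> \<le> 32 * real (q\<^sup>2 * u)" by simp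
      finally show ?thesis by (rule large)
    qed
  qed
qed

section \<open>Choice of parameters\<close>

theorem theoremB5:
  fixes \<mu> \<nu> :: nat
  assumes "erdos_girth_conjecture"
  shows "\<exists>C::real. C > 0 \<and>
    (\<forall>(n::nat)\<ge>2. \<forall>(k::nat)\<ge>1. \<forall>(f::nat)\<ge>1.
      \<exists>(V :: nat set) (E :: nat set set) (le :: nat set \<Rightarrow> nat set) (lv :: nat \<Rightarrow> nat set).
        simple_graph V E \<and> card V = n \<and> list_colored \<mu> \<nu> V E le lv \<and>
        (\<forall>H. cft_spanner f (2 * k - 1) V E le lv H \<longrightarrow>
           C * min (real f powr (real \<mu> + real \<nu> * (1 - 1 / real k)) * real n powr (1 + 1 / real k))
                   ((real n)\<^sup>2)
             \<le> real (card H)))"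
proof -
  obtain c0 :: real where c0: "0 < c0" and base: "\<And>m k. 1 \<le> m \<Longrightarrow> 1 \<le> k \<Longrightarrow>
      \<exists>B. B \<subseteq> {..<m} \<times> {..<m} \<and> spread (2 * k - 1) (bip B) \<and>
        c0 * real m powr (1 + 1 / real k) \<le> real (card B)"
    using exists_dense_spread_bip[OF assms] by blast
  define c where "c = min c0 1"
  have c: "0 < c" "c \<le> 1" "c \<le> c0" using c0 by (auto simp: c_def)
  \<comment> \<open>A fault set attacks 2 \<nu> + \<mu> digit positions; the extra 1 keeps D
    positive when \<mu> = \<nu> = 0.\<close>
  define D where "D = 2 * \<nu> + \<mu> + 1"
  \<comment> \<open>Depends on \<mu>, \<nu> and the constant of the conjecture, not on n, k or
    f.\<close>
  define C where "C = c / (32 * real D ^ (\<mu> + \<nu>))"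
  have "0 < C" using c by (simp add: C_def D_def)
  moreover have "\<exists>(V :: nat set) (E :: nat set set) (le :: nat set \<Rightarrow> nat set) (lv :: nat \<Rightarrow> nat set).
        simple_graph V E \<and> card V = n \<and> list_colored \<mu> \<nu> V E le lv \<and>
        (\<forall>H. cft_spanner f (2 * k - 1) V E le lv H \<longrightarrow>
           C * min (real f powr (real \<mu> + real \<nu> * (1 - 1 / real k)) * real n powr (1 + 1 / real k))
                   ((real n)\<^sup>2)
             \<le> real (card H))"
    if n: "2 \<le> n" and k: "1 \<le> k" and f: "1 \<le> f" for n k f :: nat
  proof -
    \<comment> \<open>Makes the fault sets fit the budget up to constants: D (s - 1) <= f < D
      s.\<close>
    define s where "s = 1 + f div D"
    \<comment> \<open>The cap n div 2 leaves at least one vertex for each of the 2 q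
      classes.\<close>
    define q where "q = min (s ^ \<nu>) (n div 2)"
    define m where "m = n div (2 * q)"
    have s0: "0 < s" by (simp add: s_def)
    have qs: "q \<le> s ^ \<nu>" by (simp add: q_def)
    have k1: "1 \<le> 2 * k - 1" using k by simp
    have q1: "1 \<le> q" using n s0 by (simp add: q_def)
    have "q \<le> n div 2" by (simp add: q_def)
    then have q2: "2 * q \<le> n" by linarith
    have m1: "1 \<le> m" using q1 q2 by (simp add: m_def Suc_le_eq div_greater_zero_iff)
    then have m0: "0 < m" by simp
    have nm: "2 * (q * m) \<le> n"
      unfolding m_def by (metis mult.assoc times_div_less_eq_dividend)
    have "n < 2 * q * (m + 1)"
      using q1 dividend_less_times_div[of "2 * q" n] by (simp add: m_def)
    \<comment> \<open>Rounding in m costs at most a factor 2, because m + 1 <= 2 m.\<close>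
    also have "\<dots> \<le> 2 * q * (m + m)" using m1 by (intro mult_left_mono) auto
    finally have nm4: "n \<le> 4 * (q * m)" by (simp add: algebra_simps)
    have "f \<le> D * s"
      using dividend_less_times_div[of D f] by (simp add: D_def s_def)
    then have fD: "real f \<le> real D * real s" by (metis of_nat_le_iff of_nat_mult)
    have "(2 * \<nu> + \<mu>) * (s - 1) \<le> D * (f div D)" by (simp add: D_def s_def)
    also have "\<dots> \<le> f" by simp
    finally have fs: "(2 * \<nu> + \<mu>) * (s - 1) \<le> f" .
    obtain B where B: "B \<subseteq> {..<m} \<times> {..<m}" "spread (2 * k - 1) (bip B)"
      and cB: "c0 * real m powr (1 + 1 / real k) \<le> real (card B)"
      using base[OF m1 k] by blast
    have cB': "c * real m powr (1 + 1 / real k) \<le> real (card B)"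
      using cB mult_right_mono[OF c(3), of "real m powr (1 + 1 / real k)"] by simp
    obtain t where t: "min (s ^ \<mu> * card B) (m\<^sup>2) \<le> 2 * card (\<Union>i<s ^ \<mu>. shift m (t i) ` B)"
      using exists_shifts_large_union[of m B "s ^ \<mu>"] m1 B(1) by auto
    note blowup = exists_list_colored_blowup[of m s q \<nu> n "2 * k - 1" \<mu> f "\<lambda>i. shift m (t i) ` B",
        OF m0 s0 qs nm k1 fs shift_subset[OF B(1)] spread_shift[OF B(2,1)]]
    obtain V :: "nat set" and E and le :: "nat set \<Rightarrow> nat set" and lv :: "nat \<Rightarrow> nat set"
      where G: "simple_graph V E" "card V = n" "list_colored \<mu> \<nu> V E le lv"
        and H: "\<And>H. cft_spanner f (2 * k - 1) V E le lv H \<Longrightarrow>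
          q\<^sup>2 * card (\<Union>i<s ^ \<mu>. shift m (t i) ` B) \<le> card H"
      using blowup by (elim exE conjE) (rule that; blast)
    \<comment> \<open>If the cap applies, q = n div 2, which is at least n / 3 for n >= 2, with
      equality at n = 3.\<close>
    have "q = s ^ \<nu> \<or> n \<le> 3 * q" using n by (auto simp: q_def min_def)
    note size = blowup_size_bound[OF n k f c(1,2) fD[unfolded D_def] q1 this m1 nm4 cB' t,
        folded D_def, folded C_def]
    show ?thesis
    proof (intro exI conjI allI impI)
      fix H assume "cft_spanner f (2 * k - 1) V E le lv H"
      then have "real (q\<^sup>2 * card (\<Union>i<s ^ \<mu>. shift m (t i) ` B)) \<le> real (card H)"
        using H of_nat_le_iff by blast
      with size show "C * min (real f powr (real \<mu> + real \<nu> * (1 - 1 / real k)) *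
          real n powr (1 + 1 / real k)) ((real n)\<^sup>2) \<le> real (card H)"
        by (rule order_trans)
    qed (fact G)+
  qed
  ultimately show ?thesis by blast
qed

end
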